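(* Let $M$ be a residuated ordered monoid, or a near residuated ordered monoid such that $\bigvee M$ exists. Let $s$ be any element of $M$ such that $s = \bigvee M$ if $\bigvee M$ exists. Then for any cyclic element $a$ of $M$ there exists a largest nucleus $v(a)$ on $M$ such that $a^{v(a)} = a$, and it is given by $$x^{v(a)} = \begin{cases} a/(a/x) = \bigvee \{y \in M_a^{LR} : a/x \leq a/y\} & \text{if } x \in M_a^{LR},\\ s & \text{otherwise}\end{cases}$$ for all $x \in M$.
   Context: An ordered monoid is a monoid $M$ with a partial order such that $x\le x'$, $y \le y'$ imply $xy \le x'y'$. For $a,x\in M$, $x/a$ denotes the largest $z\in M$ with $za\le x$, and $a\backslash x$ denotes the largest $z\in M$ with $az\le x$, when these exist. $M$ is residuated if $x/a$ and $a\backslash x$ exist for all $x,a\in M$. $M$ is near residuated if for all $a,x\in M$: $x/a$ exists whenever there is some $z\in M$ with $za\le x$, and $a\backslash x$ exists whenever there is some $z\in M$ with $az\le x$. An element $a\in M$ is cyclic if $xy\le a$ implies $yx\le a$ for all $x,y\in M$. $M_a^{LR}$ is the set of all $x\in M$ for which both $a/x$ and $x\backslash a$ are defined. A closure operation on a poset is a self-map $\star: x\mapsto x^\star$ that is expansive, order-preserving and idempotent; a nucleus on $M$ is a closure operation $\star$ on $M$ with $x^\star y^\star\le (xy)^\star$ for all $x,y\in M$. Nuclei are ordered pointwise. *)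

theory Defs
  imports Main "HOL-Library.Lub_Glb"
begin

class ordered_monoid = monoid_mult + order +
  assumes mult_mono_both: "x \<le> x' \<Longrightarrow> y \<le> y' \<Longrightarrow> x * y \<le> x' * y'"

text \<open>
  The residuals \<open>x/a\<close> and \<open>a\x\<close> are partial operations. They are rendered by
  the total functions \<open>over x a\<close> and \<open>under a x\<close>, whose values are meaningful
  only where \<open>over_defined x a\<close>, respectively \<open>under_defined a x\<close>, holds.
\<close>

definition over_defined :: "'a::ordered_monoid \<Rightarrow> 'a \<Rightarrow> bool" where
  "over_defined x a \<longleftrightarrow> (\<exists>z. z * a \<le> x \<and> (\<forall>w. w * a \<le> x \<longrightarrow> w \<le> z))"

definition over :: "'a::ordered_monoid \<Rightarrow> 'a \<Rightarrow> 'a" where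
  "over x a = (GREATEST z. z * a \<le> x)"

definition under_defined :: "'a::ordered_monoid \<Rightarrow> 'a \<Rightarrow> bool" where
  "under_defined a x \<longleftrightarrow> (\<exists>z. a * z \<le> x \<and> (\<forall>w. a * w \<le> x \<longrightarrow> w \<le> z))"

definition under :: "'a::ordered_monoid \<Rightarrow> 'a \<Rightarrow> 'a" where
  "under a x = (GREATEST z. a * z \<le> x)"

definition residuated :: "'a::ordered_monoid itself \<Rightarrow> bool" where
  "residuated _ \<longleftrightarrow> (\<forall>(a::'a) x. over_defined x a \<and> under_defined a x)"

definition near_residuated :: "'a::ordered_monoid itself \<Rightarrow> bool" where
  "near_residuated _ \<longleftrightarrow>
     (\<forall>(a::'a) x. ((\<exists>z. z * a \<le> x) \<longrightarrow> over_defined x a) \<and>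
                  ((\<exists>z. a * z \<le> x) \<longrightarrow> under_defined a x))"

definition cyclic :: "'a::ordered_monoid \<Rightarrow> bool" where
  "cyclic a \<longleftrightarrow> (\<forall>x y. x * y \<le> a \<longrightarrow> y * x \<le> a)"

definition LR :: "'a::ordered_monoid \<Rightarrow> 'a set" where
  "LR a = {x. over_defined a x \<and> under_defined x a}"

definition closure_operation :: "('a::order \<Rightarrow> 'a) \<Rightarrow> bool" where
  "closure_operation c \<longleftrightarrow> (\<forall>x. x \<le> c x) \<and> mono c \<and> (\<forall>x. c (c x) = c x)"

definition nucleus :: "('a::ordered_monoid \<Rightarrow> 'a) \<Rightarrow> bool" where
  "nucleus c \<longleftrightarrow> closure_operation c \<and> (\<forall>x y. c x * c y \<le> c (x * y))"

text \<open>The order on nuclei is the library's pointwise order on functions.\<close>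

definition largest_nucleus_fixing :: "'a::ordered_monoid \<Rightarrow> ('a \<Rightarrow> 'a) \<Rightarrow> bool" where
  "largest_nucleus_fixing a v \<longleftrightarrow>
     nucleus v \<and> v a = a \<and> (\<forall>w. nucleus w \<and> w a = a \<longrightarrow> w \<le> v)"

end

theory Submission imports Defs begin

text \<open>
  Call \<open>x\<close> and \<open>y\<close> orthogonal if \<open>y * x \<le> a\<close>. By cyclicity this relation is symmetric, so
  \<open>x \<mapsto> a / x\<close> is the polarity of a Galois connection on \<open>LR a\<close>, the set of elements orthogonal to
  something, and \<open>x \<mapsto> a / (a / x)\<close> is the associated closure. Rotating products below \<open>a\<close> makes it
  multiplicative. Outside \<open>LR a\<close> the value \<open>s\<close> is the top element. A nucleus \<open>w\<close> fixing \<open>a\<close>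
  satisfies \<open>w x * (a / x) \<le> w (x * (a / x)) \<le> w a = a\<close>, that is, \<open>w x \<le> a / (a / x)\<close>.
\<close>

lemma mult_left_mono_om: "x \<le> y \<Longrightarrow> z * x \<le> z * y" for x y z :: "'a::ordered_monoid"
  by (simp add: mult_mono_both)

lemma mult_right_mono_om: "x \<le> y \<Longrightarrow> x * z \<le> y * z" for x y z :: "'a::ordered_monoid"
  by (simp add: mult_mono_both)

lemma mult_le_trans: "x \<le> y \<Longrightarrow> z * y \<le> a \<Longrightarrow> z * x \<le> a" for x y z a :: "'a::ordered_monoid"
  by (rule order_trans[OF mult_left_mono_om])

text \<open>\<open>GREATEST\<close> has a meaningful value once a largest solution exists. The
  solutions of \<open>z * x \<le> a\<close> form a down-set by monotonicity, hence the principal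
  down-set of that value.\<close>

lemma le_over_iff:
  fixes a x z :: "'a::ordered_monoid"
  assumes "over_defined a x"
  shows "z \<le> over a x \<longleftrightarrow> z * x \<le> a"
proof -
  obtain g where g: "g * x \<le> a" "\<And>w. w * x \<le> a \<Longrightarrow> w \<le> g"
    using assms unfolding over_defined_def by blast
  have "over a x = g"
    unfolding over_def by (rule Greatest_equality) (use g in auto)
  then show ?thesis
    using g order_trans[OF mult_right_mono_om g(1)] by blast
qed

lemma residuated_imp_near_residuated:
  "residuated TYPE('a::ordered_monoid) \<Longrightarrow> near_residuated TYPE('a)"
  unfolding residuated_def near_residuated_def by blast

lemma cyclic_commute: "cyclic a \<Longrightarrow> x * y \<le> a \<longleftrightarrow> y * x \<le> a"
  unfolding cyclic_def by blast

text \<open>Cyclicity turns a left cofactor of \<open>x\<close> below \<open>a\<close> into a right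
  one, so near residuation supplies both residuals.\<close>

lemma mem_LR_iff:
  fixes a x :: "'a::ordered_monoid"
  assumes nr: "near_residuated TYPE('a)" and "cyclic a"
  shows "x \<in> LR a \<longleftrightarrow> (\<exists>z. z * x \<le> a)"
proof
  show "x \<in> LR a \<Longrightarrow> \<exists>z. z * x \<le> a"
    unfolding LR_def over_defined_def by blast
next
  assume "\<exists>z. z * x \<le> a"
  then obtain z where z: "z * x \<le> a" by blast
  then have "x * z \<le> a"
    using cyclic_commute[OF \<open>cyclic a\<close>] by blast
  with z nr show "x \<in> LR a"
    unfolding LR_def near_residuated_def by blast
qed

text \<open>The hypothesis \<open>top\<close> is vacuous when \<open>LR a\<close> is everything.
  Residuated monoids without a top element are thereby covered.\<close>

lemma cyclic_over_over_nucleus: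
  fixes s a :: "'a::ordered_monoid"
  assumes nr: "near_residuated TYPE('a)" and cyc: "cyclic a"
    and top: "\<And>x y. x \<notin> LR a \<Longrightarrow> y \<le> s"
  defines "v \<equiv> \<lambda>x. if x \<in> LR a then over a (over a x) else s"
  shows "largest_nucleus_fixing a v"
    and "x \<in> LR a \<Longrightarrow> over_defined a (over a x)"
    and "x \<in> LR a \<Longrightarrow> isLub UNIV {y \<in> LR a. over a x \<le> over a y} (v x)"
proof -
  note comm = cyclic_commute[OF cyc]
  note LR_iff = mem_LR_iff[OF nr cyc]
  have le_over: "z \<le> over a x \<longleftrightarrow> z * x \<le> a" if "x \<in> LR a" for x z
    using that le_over_iff unfolding LR_def by blast
  have over_mult: "over a x * x \<le> a" if "x \<in> LR a" for x
    using le_over[OF that] by blast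
  have over_LR: "over a x \<in> LR a" if "x \<in> LR a" for x
    using over_mult[OF that] comm LR_iff by blast
  then show od: "over_defined a (over a x)" if "x \<in> LR a" for x
    using that unfolding LR_def by blast
  have le_v: "z \<le> v x \<longleftrightarrow> z * over a x \<le> a" if "x \<in> LR a" for x z
    using that le_over over_LR by (simp add: v_def)
  have v_mult: "v x * over a x \<le> a" if "x \<in> LR a" for x
    using le_v[OF that] by blast
  have v_LR: "v x \<in> LR a" if "x \<in> LR a" for x
    using v_mult[OF that] comm LR_iff by blast
  have over_v: "over a x \<le> over a (v x)" if "x \<in> LR a" for x
    using v_mult[OF that] comm le_over[OF v_LR[OF that]] by blast
  have expansive: "x \<le> v x" for x
  proof (cases "x \<in> LR a")
    case True
    then show ?thesis using over_mult comm le_v by blast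
  qed (simp add: v_def top)
  \<comment> \<open>A cofactor of \<open>y\<close> also works for any smaller
    \<open>x\<close>.\<close>
  have LR_down: "x \<in> LR a" if "x \<le> y" "y \<in> LR a" for x y
    using mult_le_trans[OF that(1)] that(2) LR_iff by blast
  have monotone: "v x \<le> v y" if "x \<le> y" for x y
  proof (cases "y \<in> LR a")
    case True
    then have x: "x \<in> LR a" using LR_down that by blast
    \<comment> \<open>The polarity reverses order, so applying it twice preserves order.\<close>
    have "over a y * x \<le> a"
      by (rule mult_le_trans[OF that over_mult[OF True]])
    then have "over a y \<le> over a x" using le_over[OF x] by blast
    then have "v x * over a y \<le> a"
      by (rule mult_le_trans[OF _ v_mult[OF x]])
    then show ?thesis using le_v[OF True] by blast
  next
    case False
    then show ?thesis using top[OF False] by (simp add: v_def)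
  qed
  have idem: "v (v x) = v x" for x
  proof (rule antisym)
    show "v (v x) \<le> v x"
    proof (cases "x \<in> LR a")
      case True
      have "v (v x) * over a x \<le> a"
        by (rule mult_le_trans[OF over_v[OF True] v_mult[OF v_LR[OF True]]])
      then show ?thesis using le_v[OF True] by blast
    next
      case False
      then show ?thesis using top[OF False] by (simp add: v_def)
    qed
  qed (rule expansive)
  have mult: "v x * v y \<le> v (x * y)" for x y
  proof (cases "x * y \<in> LR a")
    case xy: True
    \<comment> \<open>By \<open>le_v\<close> the goal is \<open>(v x * v y) * z \<le> a\<close>.
      Starting from \<open>z * x * y \<le> a\<close>, each factor in turn is rotated to an end,
      where its cofactor lies below its polar, and is then replaced by its closure.\<close>
    define z where "z = over a (x * y)"
    have z: "(z * x) * y \<le> a"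
      using over_mult[OF xy] by (simp add: z_def mult.assoc)
    then have yzx: "(y * z) * x \<le> a"
      using comm by (metis mult.assoc)
    have x: "x \<in> LR a" and y: "y \<in> LR a"
      using z yzx LR_iff by blast+
    have "y * z \<le> over a x" using yzx le_over[OF x] by blast
    then have "v x * (y * z) \<le> a"
      by (rule mult_le_trans[OF _ v_mult[OF x]])
    then have "(z * v x) * y \<le> a"
      using comm by (metis mult.assoc)
    then have "z * v x \<le> over a y" using le_over[OF y] by blast
    then have "v y * (z * v x) \<le> a"
      by (rule mult_le_trans[OF _ v_mult[OF y]])
    then have "(v x * v y) * z \<le> a"
      using comm by (metis mult.assoc)
    then show ?thesis using le_v[OF xy] by (simp add: z_def)
  next
    case False
    then show ?thesis using top[OF False] by (simp add: v_def)
  qed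
  have nuc: "nucleus v"
    unfolding nucleus_def closure_operation_def
    using expansive monotone idem mult by (simp add: mono_def)
  have a: "a \<in> LR a" using LR_iff[of a] by (metis mult_1_left order_refl)
  \<comment> \<open>As \<open>1\<close> is orthogonal to \<open>a\<close>, multiplying
    \<open>v a\<close> by \<open>over a a\<close> cannot decrease it, yet that product is below
    \<open>a\<close>.\<close>
  have "1 \<le> over a a" using le_over[OF a] by simp
  then have "v a \<le> v a * over a a"
    using mult_left_mono_om[of 1] by fastforce
  then have "v a = a"
    using v_mult[OF a] expansive[of a] by (meson antisym order_trans)
  moreover have "w \<le> v" if w: "nucleus w" "w a = a" for w
  proof (rule le_funI)
    fix x
    show "w x \<le> v x"
    proof (cases "x \<in> LR a")
      case True
      have "w x * over a x \<le> w x * w (over a x)"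
        using w(1) mult_left_mono_om unfolding nucleus_def closure_operation_def by blast
      also have "\<dots> \<le> w (x * over a x)"
        using w(1) unfolding nucleus_def by blast
      also have "\<dots> \<le> w a"
        using w(1) over_mult[OF True] comm
        unfolding nucleus_def closure_operation_def mono_def by blast
      finally show ?thesis using le_v[OF True] w(2) by simp
    next
      case False
      then show ?thesis using top[OF False] by (simp add: v_def)
    qed
  qed
  ultimately show "largest_nucleus_fixing a v"
    unfolding largest_nucleus_fixing_def using nuc by blast
  show "isLub UNIV {y \<in> LR a. over a x \<le> over a y} (v x)" if x: "x \<in> LR a" for x
  proof (rule isLubI2)
    show "isUb UNIV {y \<in> LR a. over a x \<le> over a y} (v x)"
    proof (rule isUbI)
      show "{y \<in> LR a. over a x \<le> over a y} *<= v x"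
      proof (rule setleI, clarify)
        fix y assume "y \<in> LR a" "over a x \<le> over a y"
        \<comment> \<open>The assumption says \<open>over a x * y \<le> a\<close>; cyclicity swaps
          the factors.\<close>
        then show "y \<le> v x" using le_over comm le_v[OF x] by blast
      qed
    qed simp
    \<comment> \<open>The supremum is attained: \<open>v x\<close> itself belongs to the
      set.\<close>
    show "v x <=* Collect (isUb UNIV {y \<in> LR a. over a x \<le> over a y})"
      using v_LR[OF x] over_v[OF x] by (auto simp: setge_def isUb_def setle_def)
  qed
qed

theorem proposition5p13:
  fixes s a :: "'a::ordered_monoid"
  assumes "residuated TYPE('a) \<or>
           (near_residuated TYPE('a) \<and> (\<exists>t. isLub UNIV (UNIV :: 'a set) t))"
    and "(\<exists>t. isLub UNIV (UNIV :: 'a set) t) \<longrightarrow> isLub UNIV UNIV s"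
    and "cyclic a"
  shows "\<exists>v. largest_nucleus_fixing a v \<and>
           (\<forall>x. (x \<in> LR a \<longrightarrow>
                    over_defined a (over a x) \<and>
                    v x = over a (over a x) \<and>
                    isLub UNIV {y \<in> LR a. over a x \<le> over a y} (v x)) \<and>
                (x \<notin> LR a \<longrightarrow> v x = s))"
proof -
  have nr: "near_residuated TYPE('a)"
    using assms(1) residuated_imp_near_residuated by blast
  \<comment> \<open>An element outside \<open>LR a\<close> lacks a residual, which rules out the
    residuated case; the other case provides a top element, and \<open>s\<close> is it.\<close>
  have top: "y \<le> s" if "x \<notin> LR a" for x y
  proof -
    have "\<not> residuated TYPE('a)"
      using that unfolding residuated_def LR_def by blast
    then have "isLub UNIV UNIV s" using assms by blast
    then show ?thesis by (auto simp: isLub_def leastP_def isUb_def setle_def)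
  qed
  show ?thesis
    using cyclic_over_over_nucleus[OF nr \<open>cyclic a\<close> top]
    by (intro exI[of _ "\<lambda>x. if x \<in> LR a then over a (over a x) else s"]) auto
qed

end
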